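(* Let $H$ be a hypergraph and $M_H$ a star-dependent matrix indexed by $V(H)$. For any unit $W\in\mathfrak{U}(H)$ with $|W|\ge 2$, the vector space $C_W$ is an invariant subspace of $M_H$, i.e. $M_Hx\in C_W$ for all $x\in C_W$.
   Context: A hypergraph $H=(V(H),E(H))$ consists of a finite nonempty vertex set $V(H)$ and a finite family $E(H)$ of nonempty subsets of $V(H)$, called hyperedges. The star of a vertex $i$ is $E_i(H)=\{e\in E(H): i\in e\}$, and $\mathfrak{E}(H)=\{E_i(H): i\in V(H)\}$ is the set of all stars. A real matrix $M_H=(m_{ij})_{i,j\in V(H)}$ is star-dependent if there exist functions $g:\mathfrak{E}(H)\times\mathfrak{E}(H)\to\mathbb{R}$ and $h:\mathfrak{E}(H)\to\mathbb{R}$ such that $m_{ij}=g(E_i(H),E_j(H))$ if $i\neq j$ and $m_{ii}=h(E_i(H))$. The units of $H$ are the equivalence classes of the relation $\mathfrak{R}_s(H)=\{(i,j): E_i(H)=E_j(H)\}$ on $V(H)$; $\mathfrak{U}(H)$ is the set of all units. For $U\subseteq V(H)$, $C_U=\{x\in\mathbb{R}^{V(H)}: \text{there is } c_x\in\mathbb{R} \text{ with } x(i)=c_x \text{ for all } i\in U\}$. *)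

theory Defs
  imports "HOL-Analysis.Analysis"
begin

text \<open>
  A hypergraph is given by its set \<open>E\<close> of hyperedges over a type \<open>'v\<close> of class \<open>finite\<close>;
  the vertex set is the whole type \<open>'v\<close>, hence finite and nonempty, and \<open>E\<close> is automatically
  finite. Vectors and matrices indexed by the vertices are then \<open>real ^ 'v\<close> and
  \<open>real ^ 'v ^ 'v\<close>.
\<close>

definition hypergraph :: "'v::finite set set \<Rightarrow> bool" where
  "hypergraph E \<longleftrightarrow> (\<forall>e\<in>E. e \<noteq> {})"

definition star :: "'v::finite set set \<Rightarrow> 'v \<Rightarrow> 'v set set" where
  "star E i = {e \<in> E. i \<in> e}"

text \<open>Only the values of \<open>g\<close> and \<open>h\<close> at stars of \<open>E\<close> matter below.\<close>

definition star_dependent :: "'v::finite set set \<Rightarrow> real ^ 'v ^ 'v \<Rightarrow> bool" where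
  "star_dependent E M \<longleftrightarrow>
     (\<exists>(g :: 'v set set \<Rightarrow> 'v set set \<Rightarrow> real) (h :: 'v set set \<Rightarrow> real).
        (\<forall>i j. i \<noteq> j \<longrightarrow> M $ i $ j = g (star E i) (star E j)) \<and>
        (\<forall>i. M $ i $ i = h (star E i)))"

definition star_rel :: "'v::finite set set \<Rightarrow> ('v \<times> 'v) set" where
  "star_rel E = {(i, j). star E i = star E j}"

definition units :: "'v::finite set set \<Rightarrow> 'v set set" where
  "units E = UNIV // star_rel E"

definition const_space :: "'v::finite set \<Rightarrow> (real ^ 'v) set" where
  "const_space U = {x. \<exists>c. \<forall>i\<in>U. x $ i = c}"

definition invariant_subspace :: "real ^ 'v ^ 'v \<Rightarrow> (real ^ 'v::finite) set \<Rightarrow> bool" where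
  "invariant_subspace M S \<longleftrightarrow> subspace S \<and> (\<forall>x\<in>S. M *v x \<in> S)"

end

theory Submission
  imports Defs
begin

text \<open>
  All vertices of a unit have the same star, so exchanging two of them is a symmetry of every
  star-dependent matrix \<open>M\<close>: an entry depends only on the stars of its two indices and on whether
  these indices coincide, and a star-preserving bijection of the vertices respects both
  (\<open>star_dependent_permute\<close>). A vector \<open>x\<close> that is constant on the unit is fixed by the exchange
  as well. Hence so is \<open>M *v x\<close> (\<open>matrix_vector_mult_symmetric\<close>), which means that its coordinates
  at the two exchanged vertices agree.
\<close>

lemma star_dependent_permute:
  assumes "star_dependent E M"
    and "inj p"
    and "\<And>v. star E (p v) = star E v"
  shows "M $ p i $ p j = M $ i $ j"
proof -
  obtain g h where off_diag: "\<And>i j. i \<noteq> j \<Longrightarrow> M $ i $ j = g (star E i) (star E j)"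
    and diag: "\<And>i. M $ i $ i = h (star E i)"
    using assms(1) unfolding star_dependent_def by blast
  show ?thesis
  proof (cases "i = j")
    case True
    then show ?thesis
      using assms(3) by (simp add: diag)
  next
    case False
    then have "p i \<noteq> p j"
      using assms(2) by (simp add: inj_eq)
    with False show ?thesis
      using assms(3) by (simp add: off_diag)
  qed
qed

lemma matrix_vector_mult_symmetric:
  fixes M :: "'a::semiring_1 ^ 'n ^ 'n"
  assumes "bij p"
    and M: "\<And>i j. M $ p i $ p j = M $ i $ j"
    and x: "\<And>j. x $ p j = x $ j"
  shows "(M *v x) $ p i = (M *v x) $ i"
proof -
  have "(M *v x) $ p i = (\<Sum>j\<in>UNIV. M $ p i $ j * x $ j)"
    by (simp add: matrix_vector_mult_def)
  also have "\<dots> = (\<Sum>j\<in>UNIV. M $ p i $ p j * x $ p j)"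
    using assms(1) by (rule sum.reindex_bij_betw [symmetric])
  also have "\<dots> = (M *v x) $ i"
    by (simp add: matrix_vector_mult_def M x)
  finally show ?thesis .
qed

lemma star_eq_if_in_same_unit:
  assumes "W \<in> units E" "i \<in> W" "j \<in> W"
  shows "star E i = star E j"
  using assms by (auto simp: units_def quotient_def star_rel_def)

lemma subspace_const_space: "subspace (const_space U)"
proof (rule subspaceI)
  show "0 \<in> const_space U"
    by (simp add: const_space_def)
next
  fix x y :: "real ^ 'a"
  assume "x \<in> const_space U" "y \<in> const_space U"
  then obtain a b where "\<forall>i\<in>U. x $ i = a" "\<forall>i\<in>U. y $ i = b"
    by (auto simp: const_space_def)
  then have "\<forall>i\<in>U. (x + y) $ i = a + b"
    by simp
  then show "x + y \<in> const_space U"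
    unfolding const_space_def by blast
next
  fix r and x :: "real ^ 'a"
  assume "x \<in> const_space U"
  then obtain a where "\<forall>i\<in>U. x $ i = a"
    by (auto simp: const_space_def)
  then have "\<forall>i\<in>U. (r *\<^sub>R x) $ i = r * a"
    by simp
  then show "r *\<^sub>R x \<in> const_space U"
    unfolding const_space_def by blast
qed

theorem theorem2p16:
  fixes E :: "'v::finite set set"
    and M :: "real ^ 'v ^ 'v"
    and W :: "'v set"
  assumes "hypergraph E"
    and "star_dependent E M"
    and "W \<in> units E"
    and "card W \<ge> 2"
  shows "invariant_subspace M (const_space W)"
proof -
  have "M *v x \<in> const_space W" if x: "x \<in> const_space W" for x
  proof -
    obtain c where c: "\<forall>i\<in>W. x $ i = c"
      using x by (auto simp: const_space_def)
    have coords_eq: "(M *v x) $ k = (M *v x) $ i" if "i \<in> W" "k \<in> W" for i k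
    proof -
      define p where "p = Transposition.transpose i k"
      have "bij p"
        unfolding p_def by simp
      have "star E (p v) = star E v" for v
        using star_eq_if_in_same_unit [OF assms(3) that]
        by (simp add: p_def Transposition.transpose_def)
      then have M_sym: "M $ p a $ p b = M $ a $ b" for a b
        by (rule star_dependent_permute [OF assms(2) bij_is_inj [OF \<open>bij p\<close>]])
      have x_sym: "x $ p v = x $ v" for v
        using c that by (simp add: p_def Transposition.transpose_def)
      have "(M *v x) $ p i = (M *v x) $ i"
        by (rule matrix_vector_mult_symmetric [OF \<open>bij p\<close> M_sym x_sym])
      then show ?thesis
        by (simp add: p_def)
    qed
    have "W \<noteq> {}"
      using assms(4) by auto
    then obtain i where "i \<in> W"
      by blast
    then have "\<forall>k\<in>W. (M *v x) $ k = (M *v x) $ i"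
      by (intro ballI coords_eq)
    then show ?thesis
      unfolding const_space_def by blast
  qed
  then show ?thesis
    by (simp add: invariant_subspace_def subspace_const_space)
qed

end
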